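(* There does not exist a local map $f\colon\mathfrak{R}\to M\otimes_{\mathfrak{R}}M\otimes_{\mathfrak{R}}M\otimes_{\mathfrak{R}}M$ of level $2$.
   Context: $\mathfrak{R}=(\mathbb{Z}_2[U,Q,\theta],d)$ is the commutative dga with $\deg U=2$, $\deg Q=\deg\theta=1$, $dU=Q^3$, $dQ=d\theta=0$. $M$ is the dg $\mathfrak{R}$-module freely generated by $x_i$ ($-5\le i\le5$) and $y_j$ ($-5\le j\le5$, $j\ne0$), with $\deg x_0=0$, all other degrees determined by requiring $d$ to have degree $1$, and $dx_0=(U+\theta^2)y_1+(U+\theta^2+Q^2)y_{-1}$, $dx_1=Uy_1+(U+\theta^2)y_2+Q^2(y_{-1}+y_{-2})+Q(x_1+x_{-1})$, $dx_{-1}=Uy_{-1}+(U+\theta^2)y_{-2}+Q(x_1+x_{-1})$, $dx_2=Uy_2+U^2y_3+Q^2y_{-2}+Q(x_2+x_{-2})$, $dx_{-2}=Uy_{-2}+U^2y_{-3}+Q(x_2+x_{-2})$, $dx_3=(U+\theta^2)y_3+U(U^2+\theta^4)y_4+Q^2y_{-3}+Q^2(U^2+\theta^4)y_{-4}+Q(x_3+x_{-3})$, $dx_{-3}=(U+\theta^2)y_{-3}+U(U^2+\theta^4)y_{-4}+Q(x_3+x_{-3})$, $dx_4=Uy_4+U^2(U^2+\theta^4)y_5+Q^2y_{-4}+Q(x_4+x_{-4})$, $dx_{-4}=Uy_{-4}+U^2(U^2+\theta^4)y_{-5}+Q(x_4+x_{-4})$, $dx_5=(U+\theta^2)y_5+Q^2y_{-5}+Q(x_5+x_{-5})$,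 $dx_{-5}=(U+\theta^2)y_{-5}+Q(x_5+x_{-5})$, $dy_j=Q(y_j+y_{-j})$ for all $j$. Let $\mathfrak{R}_0=(\mathbb{Z}_2[Q,U,U^{-1}],d)$ with $dQ=0$, $dU^m=mQ^3U^{m-1}$, regarded as an $\mathfrak{R}$-module via $\theta\mapsto0$. For $\mathfrak{R}$-modules $A,B$ such that $A\otimes_{\mathfrak{R}}\mathfrak{R}_0$ and $B\otimes_{\mathfrak{R}}\mathfrak{R}_0$ are quasi-isomorphic to shifts of $\mathfrak{R}_0$, an $\mathfrak{R}$-module map $f\colon A\to B$ is local of level $i\in\{0,1,2\}$ if $f\otimes\mathrm{id}_{\mathfrak{R}_0}$ is homotopic to $Q^i\cdot f'$ for some degree-preserving $\mathfrak{R}_0$-module quasi-isomorphism $f'$; thus $f$ is homogeneous of degree $i$. Tensor products are derived (for the free module $M$ the ordinary tensor product computes them). *)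

theory Defs
  imports
    "HOL-Library.Z2"
    "HOL-Library.Poly_Mapping"
    "HOL-Computational_Algebra.Polynomial"
begin

text \<open>
  Everything lives over the field \<^typ>\<open>bit\<close> with two elements, so no Koszul signs occur.
  A commutative dga is given by its differential and its homogeneous components; its underlying
  ring is the ambient type.
\<close>

record 'r dga =
  dga_diff :: "'r \<Rightarrow> 'r"
  dga_comp :: "int \<Rightarrow> 'r set"


section \<open>The dga $\mathbb{Z}_2[U,Q,\theta]$\<close>

text \<open>
  Iterated polynomials: $U$ is the outermost variable, $Q$ the middle one, $\theta$ the
  innermost one, i.e. \<open>coeff (coeff (coeff p a) b) c\<close> is the coefficient of
  $U^a Q^b \theta^c$ in \<open>p\<close>.
\<close>

type_synonym R = "bit poly poly poly"

definition U :: R where "U = [:0, 1:]"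
definition Q :: R where "Q = [:[:0, 1:]:]"
definition \<theta> :: R where "\<theta> = [:[:[:0, 1:]:]:]"

text \<open>
  The derivation with $dU = Q^3$ and $dQ = d\theta = 0$ is $Q^3\,\partial/\partial U$.
\<close>

definition RR :: "R dga" where
  "RR = \<lparr>dga_diff = (\<lambda>p. Q ^ 3 * pderiv p),
         dga_comp = (\<lambda>n. {p. \<forall>a b c. coeff (coeff (coeff p a) b) c \<noteq> 0 \<longrightarrow>
                              2 * int a + int b + int c = n})\<rparr>"


section \<open>The dga $\mathbb{Z}_2[Q,U,U^{-1}]$\<close>

text \<open>
  Laurent polynomials in $U$ with coefficients in $\mathbb{Z}_2[Q]$:
  \<open>coeff (lookup p m) b\<close> is the coefficient of $U^m Q^b$ in \<open>p\<close>.
\<close>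

type_synonym R0 = "int \<Rightarrow>\<^sub>0 bit poly"

definition U0 :: "int \<Rightarrow> R0" where "U0 m = Poly_Mapping.single m 1"
definition Q0 :: R0 where "Q0 = Poly_Mapping.single 0 [:0, 1:]"

definition RR0 :: "R0 dga" where
  "RR0 = \<lparr>dga_diff = (\<lambda>p. \<Sum>m\<in>Poly_Mapping.keys p.
            Poly_Mapping.single m (Poly_Mapping.lookup p m) * (of_int m * Q0 ^ 3 * U0 (- 1))),
          dga_comp = (\<lambda>n. {p. \<forall>m b. coeff (Poly_Mapping.lookup p m) b \<noteq> 0 \<longrightarrow>
                               2 * m + int b = n})\<rparr>"

text \<open>
  The dga homomorphism $U \mapsto U$, $Q \mapsto Q$, $\theta \mapsto 0$ that makes
  $\mathfrak{R}_0$ an $\mathfrak{R}$-module.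
\<close>

definition to_R0 :: "R \<Rightarrow> R0" where
  "to_R0 p = poly (map_poly (\<lambda>q. Poly_Mapping.single 0 (map_poly (\<lambda>t. poly t 0) q)) p) (U0 1)"


section \<open>Free dg modules\<close>

text \<open>
  The free module over \<open>'r\<close> with basis the type \<open>'b\<close> is \<open>'b \<Rightarrow>\<^sub>0 'r\<close>. A dg structure on it is
  given by the degrees and the differentials of the basis elements. Elements need not be
  homogeneous: \<open>'b \<Rightarrow>\<^sub>0 'r\<close> is the direct sum of its components \<open>mcomp\<close>, and \<open>homology\<close> below is
  the direct sum of the homology groups in all degrees.
\<close>

definition scale :: "'r::comm_ring_1 \<Rightarrow> ('b \<Rightarrow>\<^sub>0 'r) \<Rightarrow> ('b \<Rightarrow>\<^sub>0 'r)" where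
  "scale r v = Poly_Mapping.map ((*) r) v"

abbreviation gen :: "'b \<Rightarrow> ('b \<Rightarrow>\<^sub>0 'r::comm_ring_1)" where
  "gen b \<equiv> Poly_Mapping.single b 1"

definition lin_ext ::
    "('r::comm_ring_1 \<Rightarrow> 'm \<Rightarrow> 'm) \<Rightarrow> ('b \<Rightarrow> 'm::ab_group_add) \<Rightarrow> ('b \<Rightarrow>\<^sub>0 'r) \<Rightarrow> 'm" where
  "lin_ext s g v = (\<Sum>b\<in>Poly_Mapping.keys v. s (Poly_Mapping.lookup v b) (g b))"

record (overloaded) ('b, 'r) free_dgm =
  gen_deg :: "'b \<Rightarrow> int"
  gen_diff :: "'b \<Rightarrow> ('b \<Rightarrow>\<^sub>0 'r)"

text \<open>The differential is extended by the Leibniz rule $d(rb) = dr\,b + r\,db$.\<close>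

definition mdiff ::
    "'r::comm_ring_1 dga \<Rightarrow> ('b, 'r) free_dgm \<Rightarrow> ('b \<Rightarrow>\<^sub>0 'r) \<Rightarrow> ('b \<Rightarrow>\<^sub>0 'r)" where
  "mdiff K A v =
     (\<Sum>b\<in>Poly_Mapping.keys v. Poly_Mapping.single b (dga_diff K (Poly_Mapping.lookup v b)))
     + lin_ext scale (gen_diff A) v"

definition mcomp ::
    "'r::comm_ring_1 dga \<Rightarrow> ('b, 'r) free_dgm \<Rightarrow> int \<Rightarrow> ('b \<Rightarrow>\<^sub>0 'r) set" where
  "mcomp K A n = {v. \<forall>b. Poly_Mapping.lookup v b \<in> dga_comp K (n - gen_deg A b)}"

definition self_dgm :: "(unit, 'r::comm_ring_1) free_dgm" where
  "self_dgm = \<lparr>gen_deg = (\<lambda>_. 0), gen_diff = (\<lambda>_. 0)\<rparr>"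

text \<open>
  The tensor product over the ground dga of two free modules is free on the pairs of generators;
  see \<open>tens_universal\<close> and \<open>mdiff_tens\<close> below.
\<close>

definition tens :: "('a \<Rightarrow>\<^sub>0 'r) \<Rightarrow> ('b \<Rightarrow>\<^sub>0 'r) \<Rightarrow> ('a \<times> 'b \<Rightarrow>\<^sub>0 'r::comm_ring_1)" where
  "tens v w = (\<Sum>a\<in>Poly_Mapping.keys v. \<Sum>b\<in>Poly_Mapping.keys w.
     Poly_Mapping.single (a, b) (Poly_Mapping.lookup v a * Poly_Mapping.lookup w b))"

definition tensor ::
    "('a, 'r::comm_ring_1) free_dgm \<Rightarrow> ('b, 'r) free_dgm \<Rightarrow> ('a \<times> 'b, 'r) free_dgm"
    (infixl \<open>\<otimes>\<^sub>d\<^sub>g\<close> 70) where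
  "A \<otimes>\<^sub>d\<^sub>g B = \<lparr>gen_deg = (\<lambda>(a, b). gen_deg A a + gen_deg B b),
             gen_diff = (\<lambda>(a, b). tens (gen_diff A a) (gen b) + tens (gen a) (gen_diff B b))\<rparr>"


section \<open>Maps, homotopies, quasi-isomorphisms\<close>

definition dg_map ::
    "'r::comm_ring_1 dga \<Rightarrow> ('a, 'r) free_dgm \<Rightarrow> ('b, 'r) free_dgm \<Rightarrow> int \<Rightarrow>
     (('a \<Rightarrow>\<^sub>0 'r) \<Rightarrow> ('b \<Rightarrow>\<^sub>0 'r)) \<Rightarrow> bool" where
  "dg_map K A B i f \<longleftrightarrow>
     module_hom scale scale f \<and>
     (\<forall>n. \<forall>v\<in>mcomp K A n. f v \<in> mcomp K B (n + i)) \<and>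
     (\<forall>v. mdiff K B (f v) = f (mdiff K A v))"

text \<open>Homotopy of maps that are homogeneous of degree \<open>i\<close>.\<close>

definition dg_homotopic ::
    "'r::comm_ring_1 dga \<Rightarrow> ('a, 'r) free_dgm \<Rightarrow> ('b, 'r) free_dgm \<Rightarrow> int \<Rightarrow>
     (('a \<Rightarrow>\<^sub>0 'r) \<Rightarrow> ('b \<Rightarrow>\<^sub>0 'r)) \<Rightarrow> (('a \<Rightarrow>\<^sub>0 'r) \<Rightarrow> ('b \<Rightarrow>\<^sub>0 'r)) \<Rightarrow> bool" where
  "dg_homotopic K A B i f g \<longleftrightarrow>
     (\<exists>h. module_hom scale scale h \<and>
          (\<forall>n. \<forall>v\<in>mcomp K A n. h v \<in> mcomp K B (n + i - 1)) \<and>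
          (\<forall>v. f v - g v = mdiff K B (h v) + h (mdiff K A v)))"

definition hclass ::
    "'r::comm_ring_1 dga \<Rightarrow> ('b, 'r) free_dgm \<Rightarrow> ('b \<Rightarrow>\<^sub>0 'r) \<Rightarrow> ('b \<Rightarrow>\<^sub>0 'r) set" where
  "hclass K A z = {z + mdiff K A w | w. True}"

definition homology ::
    "'r::comm_ring_1 dga \<Rightarrow> ('b, 'r) free_dgm \<Rightarrow> ('b \<Rightarrow>\<^sub>0 'r) set set" where
  "homology K A = hclass K A ` {z. mdiff K A z = 0}"

definition quasi_iso ::
    "'r::comm_ring_1 dga \<Rightarrow> ('a, 'r) free_dgm \<Rightarrow> ('b, 'r) free_dgm \<Rightarrow>
     (('a \<Rightarrow>\<^sub>0 'r) \<Rightarrow> ('b \<Rightarrow>\<^sub>0 'r)) \<Rightarrow> bool" where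
  "quasi_iso K A B f \<longleftrightarrow>
     bij_betw (\<lambda>X. \<Union>z\<in>X. hclass K B (f z)) (homology K A) (homology K B)"


section \<open>Localisation and local maps\<close>

text \<open>$A \otimes_{\mathfrak{R}} \mathfrak{R}_0$ and $f \otimes \mathrm{id}_{\mathfrak{R}_0}$.\<close>

definition bc_vec :: "('b \<Rightarrow>\<^sub>0 R) \<Rightarrow> ('b \<Rightarrow>\<^sub>0 R0)" where
  "bc_vec v = Poly_Mapping.map to_R0 v"

definition bc_dgm :: "('b, R) free_dgm \<Rightarrow> ('b, R0) free_dgm" where
  "bc_dgm A = \<lparr>gen_deg = gen_deg A, gen_diff = (\<lambda>b. bc_vec (gen_diff A b))\<rparr>"

definition bc_map ::
    "(('a \<Rightarrow>\<^sub>0 R) \<Rightarrow> ('b \<Rightarrow>\<^sub>0 R)) \<Rightarrow> (('a \<Rightarrow>\<^sub>0 R0) \<Rightarrow> ('b \<Rightarrow>\<^sub>0 R0))" where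
  "bc_map f = lin_ext scale (\<lambda>a. bc_vec (f (gen a)))"

text \<open>
  Local maps are only considered between modules whose localisations are quasi-isomorphic to
  shifts of $\mathfrak{R}_0$. This is not repeated as a conjunct: if \<open>A\<close> is $\mathfrak{R}$
  itself, then the condition holds for \<open>A\<close>, and it holds for \<open>B\<close> by the existence of \<open>f'\<close>.
\<close>

definition local_map ::
    "('a, R) free_dgm \<Rightarrow> ('b, R) free_dgm \<Rightarrow> nat \<Rightarrow> (('a \<Rightarrow>\<^sub>0 R) \<Rightarrow> ('b \<Rightarrow>\<^sub>0 R)) \<Rightarrow> bool" where
  "local_map A B i f \<longleftrightarrow>
     i \<in> {0, 1, 2} \<and> dg_map RR A B (int i) f \<and>
     (\<exists>f'. dg_map RR0 (bc_dgm A) (bc_dgm B) 0 f' \<and>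
           quasi_iso RR0 (bc_dgm A) (bc_dgm B) f' \<and>
           dg_homotopic RR0 (bc_dgm A) (bc_dgm B) (int i) (bc_map f) (\<lambda>v. scale (Q0 ^ i) (f' v)))"


section \<open>The module $M$\<close>

text \<open>
  \<open>Xp1\<close>, \<open>Xm1\<close> stand for $x_1$, $x_{-1}$, etc. The degrees are forced by $\deg x_0 = 0$ and
  $\deg d = 1$, see \<open>M_deg_unique\<close>.
\<close>

datatype M_gen =
    X0 | Xp1 | Xp2 | Xp3 | Xp4 | Xp5 | Xm1 | Xm2 | Xm3 | Xm4 | Xm5
  | Yp1 | Yp2 | Yp3 | Yp4 | Yp5 | Ym1 | Ym2 | Ym3 | Ym4 | Ym5

primrec M_deg :: "M_gen \<Rightarrow> int" where
  "M_deg X0 = 0"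
| "M_deg Xp1 = 0" | "M_deg Xm1 = 0"
| "M_deg Xp2 = 0" | "M_deg Xm2 = 0"
| "M_deg Xp3 = - 2" | "M_deg Xm3 = - 2"
| "M_deg Xp4 = - 6" | "M_deg Xm4 = - 6"
| "M_deg Xp5 = - 12" | "M_deg Xm5 = - 12"
| "M_deg Yp1 = - 1" | "M_deg Ym1 = - 1"
| "M_deg Yp2 = - 1" | "M_deg Ym2 = - 1"
| "M_deg Yp3 = - 3" | "M_deg Ym3 = - 3"
| "M_deg Yp4 = - 7" | "M_deg Ym4 = - 7"
| "M_deg Yp5 = - 13" | "M_deg Ym5 = - 13"

abbreviation cgen :: "R \<Rightarrow> M_gen \<Rightarrow> (M_gen \<Rightarrow>\<^sub>0 R)" (infixr \<open>\<cdot>\<close> 72) where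
  "r \<cdot> b \<equiv> Poly_Mapping.single b r"

primrec M_diff :: "M_gen \<Rightarrow> (M_gen \<Rightarrow>\<^sub>0 R)" where
  "M_diff X0 = (U + \<theta>^2) \<cdot> Yp1 + (U + \<theta>^2 + Q^2) \<cdot> Ym1"
| "M_diff Xp1 = U \<cdot> Yp1 + (U + \<theta>^2) \<cdot> Yp2 + (Q^2 \<cdot> Ym1 + Q^2 \<cdot> Ym2) + (Q \<cdot> Xp1 + Q \<cdot> Xm1)"
| "M_diff Xm1 = U \<cdot> Ym1 + (U + \<theta>^2) \<cdot> Ym2 + (Q \<cdot> Xp1 + Q \<cdot> Xm1)"
| "M_diff Xp2 = U \<cdot> Yp2 + U^2 \<cdot> Yp3 + Q^2 \<cdot> Ym2 + (Q \<cdot> Xp2 + Q \<cdot> Xm2)"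
| "M_diff Xm2 = U \<cdot> Ym2 + U^2 \<cdot> Ym3 + (Q \<cdot> Xp2 + Q \<cdot> Xm2)"
| "M_diff Xp3 = (U + \<theta>^2) \<cdot> Yp3 + (U * (U^2 + \<theta>^4)) \<cdot> Yp4 + Q^2 \<cdot> Ym3
                + (Q^2 * (U^2 + \<theta>^4)) \<cdot> Ym4 + (Q \<cdot> Xp3 + Q \<cdot> Xm3)"
| "M_diff Xm3 = (U + \<theta>^2) \<cdot> Ym3 + (U * (U^2 + \<theta>^4)) \<cdot> Ym4 + (Q \<cdot> Xp3 + Q \<cdot> Xm3)"
| "M_diff Xp4 = U \<cdot> Yp4 + (U^2 * (U^2 + \<theta>^4)) \<cdot> Yp5 + Q^2 \<cdot> Ym4 + (Q \<cdot> Xp4 + Q \<cdot> Xm4)"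
| "M_diff Xm4 = U \<cdot> Ym4 + (U^2 * (U^2 + \<theta>^4)) \<cdot> Ym5 + (Q \<cdot> Xp4 + Q \<cdot> Xm4)"
| "M_diff Xp5 = (U + \<theta>^2) \<cdot> Yp5 + Q^2 \<cdot> Ym5 + (Q \<cdot> Xp5 + Q \<cdot> Xm5)"
| "M_diff Xm5 = (U + \<theta>^2) \<cdot> Ym5 + (Q \<cdot> Xp5 + Q \<cdot> Xm5)"
| "M_diff Yp1 = Q \<cdot> Yp1 + Q \<cdot> Ym1" | "M_diff Ym1 = Q \<cdot> Ym1 + Q \<cdot> Yp1"
| "M_diff Yp2 = Q \<cdot> Yp2 + Q \<cdot> Ym2" | "M_diff Ym2 = Q \<cdot> Ym2 + Q \<cdot> Yp2"
| "M_diff Yp3 = Q \<cdot> Yp3 + Q \<cdot> Ym3" | "M_diff Ym3 = Q \<cdot> Ym3 + Q \<cdot> Yp3"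
| "M_diff Yp4 = Q \<cdot> Yp4 + Q \<cdot> Ym4" | "M_diff Ym4 = Q \<cdot> Ym4 + Q \<cdot> Yp4"
| "M_diff Yp5 = Q \<cdot> Yp5 + Q \<cdot> Ym5" | "M_diff Ym5 = Q \<cdot> Ym5 + Q \<cdot> Yp5"

definition M :: "(M_gen, R) free_dgm" where
  "M = \<lparr>gen_deg = M_deg, gen_diff = M_diff\<rparr>"

section \<open>Consistency of the definitions\<close>

lemma pm_sum_single:
  "(\<Sum>b\<in>Poly_Mapping.keys v. Poly_Mapping.single b (Poly_Mapping.lookup v b)) = v"
  by (rule poly_mapping_eqI)
     (auto simp: lookup_sum lookup_single when_def in_keys_iff)

lemma pm_additive_eqI:
  fixes f g :: "('b \<Rightarrow>\<^sub>0 'r::ab_group_add) \<Rightarrow> 'm::ab_group_add"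
  assumes f: "\<And>v w. f (v + w) = f v + f w"
    and g: "\<And>v w. g (v + w) = g v + g w"
    and fg: "\<And>b r. f (Poly_Mapping.single b r) = g (Poly_Mapping.single b r)"
  shows "f v = g v"
proof -
  have zero: "f 0 = 0" "g 0 = 0" using f[of 0 0] g[of 0 0] by simp_all
  have "f (\<Sum>b\<in>B. Poly_Mapping.single b (h b)) = g (\<Sum>b\<in>B. Poly_Mapping.single b (h b))" for B h
    by (induction B rule: infinite_finite_induct) (simp_all add: zero f g fg)
  from this[of "Poly_Mapping.lookup v" "Poly_Mapping.keys v"] show ?thesis
    by (simp add: pm_sum_single)
qed

lemma lookup_scale [simp]: "Poly_Mapping.lookup (scale r v) b = r * Poly_Mapping.lookup v b"
  by (simp add: scale_def Poly_Mapping.map.rep_eq when_def)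

lemma scale_single [simp]: "scale r (Poly_Mapping.single b s) = Poly_Mapping.single b (r * s)"
  by (simp add: scale_def)

interpretation scale: module scale
  by unfold_locales (auto intro!: poly_mapping_eqI simp: lookup_add algebra_simps)

lemma lin_ext_hom:
  assumes "module s"
  shows "module_hom scale s (lin_ext s g)"
proof -
  interpret s: module s by fact
  have add: "lin_ext s g (v + w) = lin_ext s g v + lin_ext s g w" for v w
    unfolding lin_ext_def
    by (rule setsum_keys_plus_distrib) (simp_all add: s.scale_left_distrib)
  have "lin_ext s g (scale c v) = s c (lin_ext s g v)" for c v
  proof (rule pm_additive_eqI)
    show "lin_ext s g (scale c (v + w)) = lin_ext s g (scale c v) + lin_ext s g (scale c w)" for v w
      by (simp add: add scale.scale_right_distrib)
    show "s c (lin_ext s g (v + w)) = s c (lin_ext s g v) + s c (lin_ext s g w)" for v w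
      by (simp add: add s.scale_right_distrib)
  qed (simp add: lin_ext_def)
  with add show ?thesis
    by (simp add: module_hom_iff assms scale.module_axioms)
qed

lemma lin_ext_single [simp]:
  assumes "module s"
  shows "lin_ext s g (Poly_Mapping.single b r) = s r (g b)"
proof -
  interpret s: module s by fact
  show ?thesis by (simp add: lin_ext_def)
qed

lemma module_hom_eqI:
  fixes f g :: "('b \<Rightarrow>\<^sub>0 'r::comm_ring_1) \<Rightarrow> 'm::ab_group_add"
  assumes f: "module_hom scale s f" and g: "module_hom scale s g"
    and gens: "\<And>b. f (gen b) = g (gen b)"
  shows "f v = g v"
proof (rule pm_additive_eqI)
  interpret f: module_hom scale s f by fact
  interpret g: module_hom scale s g by fact
  show "f (v + w) = f v + f w" "g (v + w) = g v + g w" for v w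
    by (fact f.add) (fact g.add)
  fix b r
  have "f (scale r (gen b)) = g (scale r (gen b))"
    by (simp only: f.scale g.scale gens)
  then show "f (Poly_Mapping.single b r) = g (Poly_Mapping.single b r)"
    by simp
qed


subsection \<open>The ground rings\<close>

lemma R_char2 [simp]: "(2 :: R) = 0" and R0_char2 [simp]: "(2 :: R0) = 0"
proof -
  have 2: "(2 :: bit poly) = 0"
    by (metis bit_2_eq_0 of_nat_numeral of_nat_poly pCons_0_0)
  then show "(2 :: R) = 0" by (metis numeral_poly pCons_0_0)
  show "(2 :: R0) = 0" using 2 by (metis single_numeral single_zero)
qed

lemma R_add_self [simp]: "r + r = 0" for r :: R
  by (metis R_char2 mult_2 mult_zero_left)

lemma R0_add_self [simp]: "r + r = 0" for r :: R0
  by (metis R0_char2 mult_2 mult_zero_left)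

lemma dga_diff_R_generators [simp]:
  "dga_diff RR U = Q ^ 3" "dga_diff RR Q = 0" "dga_diff RR \<theta> = 0"
  by (simp_all add: RR_def U_def Q_def \<theta>_def pderiv_pCons)

lemma dga_diff_R_add: "dga_diff RR (p + q) = dga_diff RR p + dga_diff RR q"
  by (simp add: RR_def pderiv_add algebra_simps)

lemma dga_diff_R_mult: "dga_diff RR (p * q) = dga_diff RR p * q + p * dga_diff RR q"
  by (simp add: RR_def pderiv_mult algebra_simps)

lemma dga_diff_R0_add: "dga_diff RR0 (p + q) = dga_diff RR0 p + dga_diff RR0 q"
  unfolding RR0_def dga.simps
  by (rule setsum_keys_plus_distrib) (simp_all add: single_add algebra_simps)

lemma U0_mult: "U0 m * U0 n = U0 (m + n)"
  by (simp add: U0_def mult_single)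

lemma dga_diff_R0_single:
  "dga_diff RR0 (Poly_Mapping.single m c) =
     Poly_Mapping.single m c * (of_int m * Q0 ^ 3 * U0 (- 1))"
  by (simp add: RR0_def)

lemma dga_diff_R0_generators:
  "dga_diff RR0 (U0 m) = of_int m * Q0 ^ 3 * U0 (m - 1)" "dga_diff RR0 Q0 = 0"
proof -
  have "dga_diff RR0 (U0 m) = of_int m * Q0 ^ 3 * (U0 m * U0 (- 1))"
    unfolding U0_def dga_diff_R0_single by (simp add: U0_def mult_ac)
  then show "dga_diff RR0 (U0 m) = of_int m * Q0 ^ 3 * U0 (m - 1)"
    by (simp add: U0_mult)
  have "dga_diff RR0 (Poly_Mapping.single 0 [:0, 1:]) = 0"
    by (subst dga_diff_R0_single) simp
  then show "dga_diff RR0 Q0 = 0" by (simp only: Q0_def)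
qed

lemma dga_diff_R0_mult: "dga_diff RR0 (p * q) = dga_diff RR0 p * q + p * dga_diff RR0 q"
proof (rule pm_additive_eqI[where v = p])
  fix m c
  show "dga_diff RR0 (Poly_Mapping.single m c * q) =
      dga_diff RR0 (Poly_Mapping.single m c) * q + Poly_Mapping.single m c * dga_diff RR0 q"
  proof (rule pm_additive_eqI[where v = q])
    fix n e
    have "dga_diff RR0 (Poly_Mapping.single m c * Poly_Mapping.single n e) =
        Poly_Mapping.single m c * Poly_Mapping.single n e * (of_int (m + n) * Q0 ^ 3 * U0 (- 1))"
      by (simp only: mult_single dga_diff_R0_single)
    then show "dga_diff RR0 (Poly_Mapping.single m c * Poly_Mapping.single n e) =
        dga_diff RR0 (Poly_Mapping.single m c) * Poly_Mapping.single n e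
        + Poly_Mapping.single m c * dga_diff RR0 (Poly_Mapping.single n e)"
      by (simp only: dga_diff_R0_single of_int_add) (simp only: algebra_simps)
  qed (simp_all add: algebra_simps dga_diff_R0_add)
qed (simp_all add: algebra_simps dga_diff_R0_add)

lemma map_poly_hom:
  fixes h :: "'r::comm_ring_1 \<Rightarrow> 's::comm_ring_1"
  assumes h: "h 0 = 0" "\<And>x y. h (x + y) = h x + h y" "\<And>x y. h (x * y) = h x * h y"
  shows "map_poly h (p + q) = map_poly h p + map_poly h q"
    and "map_poly h (p * q) = map_poly h p * map_poly h q"
proof -
  have sum: "h (\<Sum>i\<in>I. k i) = (\<Sum>i\<in>I. h (k i))" for I :: "nat set" and k
    by (induction I rule: infinite_finite_induct) (simp_all add: h)
  show "map_poly h (p + q) = map_poly h p + map_poly h q"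
    and "map_poly h (p * q) = map_poly h p * map_poly h q"
    by (auto intro!: poly_eqI simp: coeff_map_poly coeff_mult sum h)
qed

lemma to_R0_hom:
  "to_R0 0 = 0" "to_R0 1 = 1" "to_R0 (p + q) = to_R0 p + to_R0 q" "to_R0 (p * q) = to_R0 p * to_R0 q"
proof -
  define h :: "bit poly poly \<Rightarrow> R0"
    where "h = (\<lambda>q. Poly_Mapping.single 0 (map_poly (\<lambda>t. poly t 0) q))"
  have "h 0 = 0" "h (x + y) = h x + h y" "h (x * y) = h x * h y" for x y
    by (simp_all add: h_def map_poly_hom single_add mult_single)
  then show "to_R0 (p + q) = to_R0 p + to_R0 q" "to_R0 (p * q) = to_R0 p * to_R0 q"
    by (simp_all add: to_R0_def map_poly_hom flip: h_def)
qed (simp_all add: to_R0_def map_poly_1')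

lemma to_R0_generators: "to_R0 U = U0 1" "to_R0 Q = Q0" "to_R0 \<theta> = 0"
  by (simp_all add: to_R0_def U_def Q_def \<theta>_def Q0_def map_poly_pCons)

lemma to_R0_diff: "to_R0 (dga_diff RR p) = dga_diff RR0 (to_R0 p)"
proof (induction p)
  case 0
  show ?case by (simp add: RR_def RR0_def to_R0_hom)
next
  case (pCons a p)
  have p: "pCons a p = [:a:] + U * p"
    by (simp add: U_def)
  have "dga_diff RR0 (to_R0 [:a:]) = 0"
    by (simp add: to_R0_def map_poly_pCons dga_diff_R0_single)
  moreover have "dga_diff RR [:a:] = 0"
    by (simp add: RR_def pderiv_pCons)
  moreover have "to_R0 (Q ^ 3) = Q0 ^ 3"
    by (simp add: power3_eq_cube to_R0_hom to_R0_generators)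
  ultimately show ?case
    using pCons.IH dga_diff_R0_generators(1)[of 1]
    by (simp add: p dga_diff_R_add dga_diff_R_mult dga_diff_R0_add dga_diff_R0_mult to_R0_hom
        to_R0_generators U0_def)
qed

lemma dga_diff_R_twice: "dga_diff RR (dga_diff RR p) = 0"
proof -
  have "coeff (pderiv (pderiv p)) n = 0" for n
  proof -
    have "coeff (pderiv (pderiv p)) n = of_nat (Suc n * Suc (Suc n)) * coeff p (Suc (Suc n))"
      by (simp only: coeff_pderiv of_nat_mult mult.assoc)
    moreover have "(of_nat (Suc n * Suc (Suc n)) :: bit poly poly) = 0"
    proof -
      have "even (Suc n * Suc (Suc n))" by simp
      then obtain k where "Suc n * Suc (Suc n) = 2 * k" by blast
      moreover have "(2 :: bit poly poly) = 0"
        by (metis bit_2_eq_0 of_nat_numeral of_nat_poly pCons_0_0)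
      ultimately show ?thesis by (metis mult_zero_left of_nat_mult of_nat_numeral)
    qed
    ultimately show ?thesis by simp
  qed
  then have "pderiv (pderiv p) = 0" by (simp add: poly_eq_iff)
  then show ?thesis by (simp add: RR_def Q_def pderiv_mult pderiv_power pderiv_pCons)
qed

lemma dga_comp_R_generators: "U \<in> dga_comp RR 2" "Q \<in> dga_comp RR 1" "\<theta> \<in> dga_comp RR 1"
  by (auto simp: RR_def U_def Q_def \<theta>_def coeff_pCons split: nat.splits)

lemma dga_comp_R_add: "p \<in> dga_comp RR n \<Longrightarrow> q \<in> dga_comp RR n \<Longrightarrow> p + q \<in> dga_comp RR n"
  by (auto simp: RR_def)

lemma dga_comp_R_mult:
  assumes "p \<in> dga_comp RR m" "q \<in> dga_comp RR n"
  shows "p * q \<in> dga_comp RR (m + n)"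
proof -
  have "2 * int a + int b + int c = m + n" if nz: "coeff (coeff (coeff (p * q) a) b) c \<noteq> 0" for a b c
  proof -
    obtain i where i: "i \<le> a" "coeff (coeff (coeff p i * coeff q (a - i)) b) c \<noteq> 0"
      using nz that by (auto simp: coeff_mult[of p] coeff_sum simp del: bit_not_zero_iff elim!: sum.not_neutral_contains_not_neutral)
    obtain j where j: "j \<le> b" "coeff (coeff (coeff p i) j * coeff (coeff q (a - i)) (b - j)) c \<noteq> 0"
      using i(2) that by (auto simp: coeff_mult[of "coeff p i"] coeff_sum simp del: bit_not_zero_iff elim!: sum.not_neutral_contains_not_neutral)
    obtain k where k: "k \<le> c"
      "coeff (coeff (coeff p i) j) k * coeff (coeff (coeff q (a - i)) (b - j)) (c - k) \<noteq> 0"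
      using j(2) that unfolding coeff_mult[of "coeff (coeff p i) j"]
      by (metis (no_types, lifting) atMost_iff sum.not_neutral_contains_not_neutral)
    have "2 * int i + int j + int k = m" "2 * int (a - i) + int (b - j) + int (c - k) = n"
      using assms k(2) by (auto simp: RR_def)
    then show ?thesis using i(1) j(1) k(1) by (simp add: of_nat_diff)
  qed
  then show ?thesis by (simp add: RR_def)
qed


subsection \<open>Differentials, tensor products and base change\<close>

locale derivation_dga =
  fixes K :: "'r::comm_ring_1 dga"
  assumes diff_add: "dga_diff K (p + q) = dga_diff K p + dga_diff K q"
    and diff_mult: "dga_diff K (p * q) = dga_diff K p * q + p * dga_diff K q"
begin

lemma diff_0 [simp]: "dga_diff K 0 = 0"
  using diff_add[of 0 0] by simp

lemma diff_1 [simp]: "dga_diff K 1 = 0"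
  using diff_mult[of 1 1] by simp

lemma mdiff_add: "mdiff K A (v + w) = mdiff K A v + mdiff K A w"
proof -
  have "(\<Sum>b\<in>Poly_Mapping.keys (v + w). Poly_Mapping.single b (dga_diff K (Poly_Mapping.lookup (v + w) b))) =
     (\<Sum>b\<in>Poly_Mapping.keys v. Poly_Mapping.single b (dga_diff K (Poly_Mapping.lookup v b)))
     + (\<Sum>b\<in>Poly_Mapping.keys w. Poly_Mapping.single b (dga_diff K (Poly_Mapping.lookup w b)))"
    by (rule setsum_keys_plus_distrib) (simp_all add: diff_add single_add)
  moreover have "lin_ext scale (gen_diff A) (v + w) = lin_ext scale (gen_diff A) v + lin_ext scale (gen_diff A) w"
    using lin_ext_hom[OF scale.module_axioms, of "gen_diff A"] unfolding module_hom_iff by blast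
  ultimately show ?thesis by (simp add: mdiff_def)
qed

lemma mdiff_single:
  "mdiff K A (Poly_Mapping.single b r) =
     Poly_Mapping.single b (dga_diff K r) + scale r (gen_diff A b)"
  by (simp add: mdiff_def lin_ext_single[OF scale.module_axioms])

lemma mdiff_gen: "mdiff K A (gen b) = gen_diff A b"
  by (simp add: mdiff_single)

lemma mdiff_scale: "mdiff K A (scale r v) = scale (dga_diff K r) v + scale r (mdiff K A v)"
  by (rule pm_additive_eqI[where v = v])
     (simp_all add: mdiff_add mdiff_single scale.scale_right_distrib diff_mult single_add
        ac_simps)

end

interpretation RR: derivation_dga RR
  by unfold_locales (fact dga_diff_R_add dga_diff_R_mult)+

interpretation RR0: derivation_dga RR0
  by unfold_locales (fact dga_diff_R0_add dga_diff_R0_mult)+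

lemma lookup_tens [simp]:
  "Poly_Mapping.lookup (tens v w) (a, b) = Poly_Mapping.lookup v a * Poly_Mapping.lookup w b"
proof -
  have "Poly_Mapping.lookup (tens v w) (a, b) =
      (\<Sum>a'\<in>Poly_Mapping.keys v. \<Sum>b'\<in>Poly_Mapping.keys w.
         if b' = b then if a' = a then Poly_Mapping.lookup v a * Poly_Mapping.lookup w b else 0 else 0)"
    unfolding tens_def lookup_sum by (intro sum.cong refl) (auto simp: lookup_single when_def)
  also have "\<dots> = Poly_Mapping.lookup v a * Poly_Mapping.lookup w b"
    by (cases "Poly_Mapping.lookup w b = 0") (simp_all add: in_keys_iff sum.delta)
  finally show ?thesis .
qed

lemma tens_bilinear:
  "module_hom scale scale (\<lambda>v. tens v w)" "module_hom scale scale (\<lambda>w. tens v w)"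
  by (auto simp: module_hom_iff scale.module_axioms lookup_add algebra_simps
      intro!: poly_mapping_eqI)

lemma tens_single [simp]:
  "tens (Poly_Mapping.single a r) (Poly_Mapping.single b s) = Poly_Mapping.single (a, b) (r * s)"
  by (auto intro!: poly_mapping_eqI simp: lookup_single when_def)

lemma tens_universal:
  fixes \<beta> :: "('a \<Rightarrow>\<^sub>0 'r::comm_ring_1) \<Rightarrow> ('b \<Rightarrow>\<^sub>0 'r) \<Rightarrow> 'm::ab_group_add"
  assumes \<beta>1: "\<And>w. module_hom scale s (\<lambda>v. \<beta> v w)"
    and \<beta>2: "\<And>v. module_hom scale s (\<beta> v)"
  shows "\<exists>!g. module_hom scale s g \<and> (\<forall>v w. g (tens v w) = \<beta> v w)"
proof -
  interpret s: module s
    using \<beta>2[of 0] by (simp add: module_hom_iff)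
  define g where "g = lin_ext s (\<lambda>(a, b). \<beta> (gen a) (gen b))"
  have g: "module_hom scale s g"
    unfolding g_def by (rule lin_ext_hom) (fact s.module_axioms)
  have uniq: "g' = g" if g': "module_hom scale s g'" "\<forall>v w. g' (tens v w) = \<beta> v w" for g'
  proof
    fix v
    have "g' (gen (a, b)) = g (gen (a, b))" for a b
    proof -
      have "g' (gen (a, b)) = g' (tens (gen a) (gen b))" by simp
      also have "\<dots> = \<beta> (gen a) (gen b)" using g' by blast
      finally show ?thesis by (simp add: g_def lin_ext_single[OF s.module_axioms])
    qed
    then show "g' v = g v"
      by (metis module_hom_eqI[OF g'(1) g] prod.exhaust)
  qed
  have "g (tens v w) = \<beta> v w" for v w
  proof (rule module_hom_eqI[OF _ \<beta>1])
    show "module_hom scale s (\<lambda>v. g (tens v w))"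
      using module_hom_compose[OF tens_bilinear(1) g] by (simp add: o_def)
    fix a
    show "g (tens (gen a) w) = \<beta> (gen a) w"
    proof (rule module_hom_eqI[OF _ \<beta>2])
      show "module_hom scale s (\<lambda>w. g (tens (gen a) w))"
        using module_hom_compose[OF tens_bilinear(2) g] by (simp add: o_def)
    qed (simp add: g_def lin_ext_single[OF s.module_axioms])
  qed
  with g uniq show ?thesis by blast
qed

lemma (in derivation_dga) mdiff_tens:
  fixes A :: "('a, 'r) free_dgm" and B :: "('b, 'r) free_dgm"
  shows "mdiff K (A \<otimes>\<^sub>d\<^sub>g B) (tens v w) = tens (mdiff K A v) w + tens v (mdiff K B w)"
proof -
  have t: "tens (v + v') w = tens v w + tens v' w" "tens v (w + w') = tens v w + tens v w'"
    "tens (scale r v) w = scale r (tens v w)" "tens v (scale r w) = scale r (tens v w)"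
    for r and v v' :: "'a \<Rightarrow>\<^sub>0 'r" and w w' :: "'b \<Rightarrow>\<^sub>0 'r"
    using tens_bilinear unfolding module_hom_iff by blast+
  show ?thesis
  proof (rule pm_additive_eqI[where v = v])
    fix a :: 'a and r :: 'r
    show "mdiff K (A \<otimes>\<^sub>d\<^sub>g B) (tens (Poly_Mapping.single a r) w) =
        tens (mdiff K A (Poly_Mapping.single a r)) w + tens (Poly_Mapping.single a r) (mdiff K B w)"
    proof (rule pm_additive_eqI[where v = w])
      fix b :: 'b and s :: 'r
      have 1: "tens v (Poly_Mapping.single b s) = scale s (tens v (gen b))" for v :: "'a \<Rightarrow>\<^sub>0 'r"
        using t(4)[of v s "gen b"] by simp
      have 2: "tens (Poly_Mapping.single a r) w = scale r (tens (gen a) w)" for w :: "'b \<Rightarrow>\<^sub>0 'r"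
        using t(3)[of r "gen a" w] by simp
      show "mdiff K (A \<otimes>\<^sub>d\<^sub>g B) (tens (Poly_Mapping.single a r) (Poly_Mapping.single b s)) =
          tens (mdiff K A (Poly_Mapping.single a r)) (Poly_Mapping.single b s)
          + tens (Poly_Mapping.single a r) (mdiff K B (Poly_Mapping.single b s))"
        by (simp add: mdiff_single t diff_mult tensor_def scale.scale_right_distrib single_add)
           (simp add: 1 2 t mult_ac add_ac)
    qed (simp_all add: mdiff_add t algebra_simps)
  qed (simp_all add: mdiff_add t algebra_simps)
qed

lemma lookup_bc_vec [simp]: "Poly_Mapping.lookup (bc_vec v) b = to_R0 (Poly_Mapping.lookup v b)"
  by (simp add: bc_vec_def Poly_Mapping.map.rep_eq when_def to_R0_hom)

lemma bc_vec_hom: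
  "bc_vec (v + w) = bc_vec v + bc_vec w" "bc_vec (scale r v) = scale (to_R0 r) (bc_vec v)"
  "bc_vec (Poly_Mapping.single b r) = Poly_Mapping.single b (to_R0 r)"
  by (auto intro!: poly_mapping_eqI simp: lookup_add to_R0_hom lookup_single when_def)

lemma mdiff_bc_vec: "mdiff RR0 (bc_dgm A) (bc_vec v) = bc_vec (mdiff RR A v)"
  by (rule pm_additive_eqI[where v = v])
     (simp_all add: bc_vec_hom RR.mdiff_add RR0.mdiff_add RR.mdiff_single RR0.mdiff_single
        to_R0_diff bc_dgm_def)

lemma bc_map_bc_vec:
  assumes "module_hom scale scale f"
  shows "bc_map f (bc_vec v) = bc_vec (f v)"
proof (rule pm_additive_eqI[where v = v])
  interpret f: module_hom scale scale f by fact
  have bc: "module_hom scale scale (bc_map f)"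
    unfolding bc_map_def by (rule lin_ext_hom) (fact scale.module_axioms)
  show "bc_map f (bc_vec (v + w)) = bc_map f (bc_vec v) + bc_map f (bc_vec w)" for v w
    using bc by (simp add: bc_vec_hom module_hom_iff)
  show "bc_vec (f (v + w)) = bc_vec (f v) + bc_vec (f w)" for v w
    by (simp add: f.add bc_vec_hom)
  show "bc_map f (bc_vec (Poly_Mapping.single b r)) = bc_vec (f (Poly_Mapping.single b r))" for b r
    using f.scale[of r "gen b"]
    by (simp add: bc_map_def bc_vec_hom lin_ext_single[OF scale.module_axioms])
qed

lemma self_dgm_diff: "mdiff RR self_dgm (Poly_Mapping.single () r) = Poly_Mapping.single () (dga_diff RR r)"
  by (simp add: RR.mdiff_single self_dgm_def)


subsection \<open>The module $M$\<close>

lemma gen_diff_M [simp]: "gen_diff M = M_diff" and gen_deg_M [simp]: "gen_deg M = M_deg"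
  by (simp_all add: M_def)

lemma R_add_self_left: "r + (r + s) = s" for r s :: R
  by (simp flip: add.assoc)

lemma dga_diff_R_power: "dga_diff RR (p ^ n) = of_nat n * p ^ (n - 1) * dga_diff RR p"
  by (induction n) (auto simp: dga_diff_R_mult algebra_simps power_eq_if)

lemma R_4 [simp]: "(4 :: R) = 0"
  by (metis R_char2 mult_2 mult_zero_left numeral_Bit0)

lemma M_diff_twice_gen: "mdiff RR M (M_diff b) = 0"
proof -
  note d = RR.mdiff_add RR.mdiff_single dga_diff_R_add dga_diff_R_mult dga_diff_R_power
    scale.scale_right_distrib single_add distrib_left distrib_right power2_eq_square
    power3_eq_cube add_ac mult_ac
  have s: "Poly_Mapping.single k r + Poly_Mapping.single k r = 0"
    "Poly_Mapping.single k r + (Poly_Mapping.single k r + v) = v"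
    for k :: M_gen and r :: R and v
    by (simp_all flip: single_add add.assoc)
  show ?thesis
    by (cases b) (simp_all add: d s)
qed

lemma M_diff_twice: "mdiff RR M (mdiff RR M v) = 0"
proof (rule pm_additive_eqI[where v = v])
  show "mdiff RR M (mdiff RR M (Poly_Mapping.single b r)) = 0" for b r
  proof -
    have "mdiff RR M (mdiff RR M (Poly_Mapping.single b r)) =
        scale (dga_diff RR r) (M_diff b) + scale (dga_diff RR r) (M_diff b)"
      by (simp add: RR.mdiff_single RR.mdiff_add RR.mdiff_scale dga_diff_R_twice M_diff_twice_gen)
    also have "\<dots> = 0"
      by (rule poly_mapping_eqI) (simp add: lookup_add)
    finally show ?thesis .
  qed
qed (simp_all add: RR.mdiff_add)

lemma dga_comp_R_0: "0 \<in> dga_comp RR n"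
  by (simp add: RR_def)

lemma dga_comp_R_unique: "p \<in> dga_comp RR m \<Longrightarrow> p \<in> dga_comp RR n \<Longrightarrow> p \<noteq> 0 \<Longrightarrow> m = n"
  by (simp add: RR_def del: bit_not_zero_iff) (metis coeff_0 poly_eqI)

lemma M_coeffs_homogeneous:
  "U + \<theta>^2 \<in> dga_comp RR 2" "Q^2 \<in> dga_comp RR 2" "U + \<theta>^2 + Q^2 \<in> dga_comp RR 2"
  "U^2 \<in> dga_comp RR 4" "U * (U^2 + \<theta>^4) \<in> dga_comp RR 6"
  "Q^2 * (U^2 + \<theta>^4) \<in> dga_comp RR 6" "U^2 * (U^2 + \<theta>^4) \<in> dga_comp RR 8"
proof -
  have 1: "Q^2 \<in> dga_comp RR 2" "\<theta>^2 \<in> dga_comp RR 2" "U^2 \<in> dga_comp RR 4"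
    using dga_comp_R_mult[of Q 1 Q 1] dga_comp_R_mult[of \<theta> 1 \<theta> 1] dga_comp_R_mult[of U 2 U 2]
    by (simp_all add: dga_comp_R_generators power2_eq_square)
  moreover have "\<theta>^4 \<in> dga_comp RR 4"
    using dga_comp_R_mult[OF 1(2) 1(2)] by (simp flip: power_add)
  ultimately have 2: "U^2 + \<theta>^4 \<in> dga_comp RR 4"
    by (simp add: dga_comp_R_add)
  show "U + \<theta>^2 \<in> dga_comp RR 2" "Q^2 \<in> dga_comp RR 2" "U + \<theta>^2 + Q^2 \<in> dga_comp RR 2"
    "U^2 \<in> dga_comp RR 4" "U * (U^2 + \<theta>^4) \<in> dga_comp RR 6"
    "Q^2 * (U^2 + \<theta>^4) \<in> dga_comp RR 6" "U^2 * (U^2 + \<theta>^4) \<in> dga_comp RR 8"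
    using dga_comp_R_mult[OF dga_comp_R_generators(1) 2] dga_comp_R_mult[OF 1(1) 2]
      dga_comp_R_mult[OF 1(3) 2] 1
    by (simp_all add: dga_comp_R_add dga_comp_R_generators)
qed

lemma M_diff_degree: "M_diff b \<in> mcomp RR M (M_deg b + 1)"
  by (cases b)
     (auto simp: mcomp_def lookup_add lookup_single when_def dga_comp_R_0 dga_comp_R_generators
        M_coeffs_homogeneous)

lemma M_deg_unique:
  assumes X0: "deg X0 = 0"
    and deg: "\<And>b. M_diff b \<in> mcomp RR \<lparr>gen_deg = deg, gen_diff = M_diff\<rparr> (deg b + 1)"
  shows "deg = M_deg"
proof -
  have nz: "U \<noteq> 0" "Q \<noteq> 0" "U + \<theta>^2 \<noteq> 0" "U^2 + \<theta>^4 \<noteq> 0" "U + \<theta>^2 + Q^2 \<noteq> 0"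
  proof -
    show "U \<noteq> 0" "Q \<noteq> 0" by (simp_all add: U_def Q_def)
    have "coeff (U + \<theta>^2) 1 \<noteq> 0" "coeff (U^2 + \<theta>^4) 2 \<noteq> 0" "coeff (U + \<theta>^2 + Q^2) 1 \<noteq> 0"
      by (simp_all add: U_def \<theta>_def Q_def power2_eq_square numeral_eq_Suc)
    then show "U + \<theta>^2 \<noteq> 0" "U^2 + \<theta>^4 \<noteq> 0" "U + \<theta>^2 + Q^2 \<noteq> 0"
      by (metis coeff_0)+
  qed
  have *: "deg c = deg b + 1 - n"
    if "Poly_Mapping.lookup (M_diff b) c = p" "p \<in> dga_comp RR n" "p \<noteq> 0" for b c p n
    using deg[of b] that dga_comp_R_unique[of p "deg b + 1 - deg c" n]
    by (auto simp: mcomp_def)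
  note ** = *[OF _ M_coeffs_homogeneous(1)] *[OF _ M_coeffs_homogeneous(3)]
    *[OF _ M_coeffs_homogeneous(4)] *[OF _ M_coeffs_homogeneous(5)]
    *[OF _ M_coeffs_homogeneous(7)]
    *[OF _ dga_comp_R_generators(1)] *[OF _ dga_comp_R_generators(2)]
  have "deg Yp1 = deg X0 + 1 - 2" "deg Ym1 = deg X0 + 1 - 2"
    "deg Yp1 = deg Xp1 + 1 - 2" "deg Ym1 = deg Xm1 + 1 - 2"
    "deg Yp2 = deg Xp1 + 1 - 2" "deg Ym2 = deg Xm1 + 1 - 2"
    "deg Yp2 = deg Xp2 + 1 - 2" "deg Ym2 = deg Xm2 + 1 - 2"
    "deg Yp3 = deg Xp2 + 1 - 4" "deg Ym3 = deg Xm2 + 1 - 4"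
    "deg Yp3 = deg Xp3 + 1 - 2" "deg Ym3 = deg Xm3 + 1 - 2"
    "deg Yp4 = deg Xp3 + 1 - 6" "deg Ym4 = deg Xm3 + 1 - 6"
    "deg Yp4 = deg Xp4 + 1 - 2" "deg Ym4 = deg Xm4 + 1 - 2"
    "deg Yp5 = deg Xp4 + 1 - 8" "deg Ym5 = deg Xm4 + 1 - 8"
    "deg Yp5 = deg Xp5 + 1 - 2" "deg Ym5 = deg Xm5 + 1 - 2"
    by (rule **; simp add: lookup_add lookup_single when_def nz)+
  with X0 have "deg b = M_deg b" for b
    by (cases b) simp_all
  then show ?thesis by blast
qed

end

theory Submission
  imports Defs
begin

text \<open>
  No differential of a generator involves $x_0$, so the coefficient of $x_0^{\otimes 4}$ is a chain
  map from $M^{\otimes 4}$ to the ground dga. After localisation it is surjective in homology,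
  because $x_0$ extends to a cycle of $M \otimes \mathfrak{R}_0$. Hence a local map of level 2 sends
  1 to a cycle $z$ whose $x_0^{\otimes 4}$-coefficient contains the monomial $Q^2$.

  This is impossible already modulo $(U, Q^3)$. There $x_1$ and $x_{-1}$ contribute to $y_{\pm 1}$
  only in order $Q^2$, with coefficients that are themselves divisible by $Q$ in the step where the
  order $Q^2$ matters, and $\theta^2 x_0$ has to be compensated by $Q y_{\pm 1}$. Exchanging
  the factors $x_0$ one at a time, from $x_0 x_0 x_0$ to $y x_0 x_0$, to $y y x_0$ and beyond,
  where $y$ stands for the sum of the coefficients at $y_1$ and $y_{-1}$, shows that three factors
  force $Q^3$ to divide $\theta^6$ times the coefficient at $x_0^{\otimes 4}$. The fourth factor
  plays no role.
\<close>

lemma UNIV_M_gen: "UNIV = {X0, Xp1, Xp2, Xp3, Xp4, Xp5, Xm1, Xm2, Xm3, Xm4, Xm5,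
    Yp1, Yp2, Yp3, Yp4, Yp5, Ym1, Ym2, Ym3, Ym4, Ym5}"
  by (auto intro: M_gen.exhaust)

instance M_gen :: finite
  by standard (simp add: UNIV_M_gen)

text \<open>The part of the differential that is linear over the ground ring, in coordinates.\<close>

definition coeff_diff ::
    "('b::finite, 'r::comm_ring_1) free_dgm \<Rightarrow> ('b \<Rightarrow> 'r) \<Rightarrow> 'b \<Rightarrow> 'r" where
  "coeff_diff A f b = (\<Sum>a\<in>UNIV. f a * Poly_Mapping.lookup (gen_diff A a) b)"

lemma (in derivation_dga) lookup_mdiff:
  fixes A :: "('b::finite, 'r) free_dgm"
  shows "Poly_Mapping.lookup (mdiff K A v) b =
    dga_diff K (Poly_Mapping.lookup v b) + coeff_diff A (Poly_Mapping.lookup v) b"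
proof -
  have "Poly_Mapping.lookup
      (\<Sum>a\<in>Poly_Mapping.keys v. Poly_Mapping.single a (dga_diff K (Poly_Mapping.lookup v a))) b =
      dga_diff K (Poly_Mapping.lookup v b)"
    by (auto simp: lookup_sum lookup_single when_def in_keys_iff)
  moreover have "Poly_Mapping.lookup (lin_ext scale (gen_diff A) v) b =
      coeff_diff A (Poly_Mapping.lookup v) b"
    unfolding lin_ext_def coeff_diff_def lookup_sum lookup_scale
    by (rule sum.mono_neutral_left) (auto simp: in_keys_iff)
  ultimately show ?thesis by (simp add: mdiff_def lookup_add)
qed

text \<open>Iterated, this lets the differential of a fourfold product act in one slot at a time
  with the other slots frozen.\<close>

lemma coeff_diff_tensor:
  fixes A :: "('a::finite, 'r::comm_ring_1) free_dgm" and B :: "('b::finite, 'r) free_dgm"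
  shows "coeff_diff (A \<otimes>\<^sub>d\<^sub>g B) f (a, b) =
    coeff_diff A (\<lambda>a'. f (a', b)) a + coeff_diff B (\<lambda>b'. f (a, b')) b"
proof -
  have "coeff_diff (A \<otimes>\<^sub>d\<^sub>g B) f (a, b) =
      (\<Sum>a'\<in>UNIV. \<Sum>b'\<in>UNIV.
         (if b' = b then f (a', b') * Poly_Mapping.lookup (gen_diff A a') a else 0)
         + (if a' = a then f (a', b') * Poly_Mapping.lookup (gen_diff B b') b else 0))"
    unfolding coeff_diff_def UNIV_Times_UNIV[symmetric] sum.cartesian_product
    by (rule sum.cong)
       (auto simp: tensor_def lookup_add lookup_single when_def algebra_simps)
  moreover have "(\<Sum>a'\<in>UNIV. \<Sum>b'\<in>UNIV.
         if a' = a then f (a', b') * Poly_Mapping.lookup (gen_diff B b') b else 0) =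
      (\<Sum>b'\<in>UNIV. \<Sum>a'\<in>UNIV.
         if a' = a then f (a', b') * Poly_Mapping.lookup (gen_diff B b') b else 0)"
    by (rule sum.swap)
  ultimately show ?thesis by (simp add: coeff_diff_def sum.distrib)
qed

section \<open>Coefficients and divisibility by \<open>Q0\<close> after localisation\<close>

lemma lookup_single_times:
  fixes x :: R0
  shows "Poly_Mapping.lookup (Poly_Mapping.single k c * x) m = c * Poly_Mapping.lookup x (m - k)"
  by (rule pm_additive_eqI[where v = x])
     (auto simp: algebra_simps lookup_add mult_single lookup_single when_def)

lemma Q0_power: "Q0 ^ n = Poly_Mapping.single 0 ([:0, 1:] ^ n)"
  by (induction n) (simp_all add: Q0_def mult_single)

lemma lookup_to_R0:
  "Poly_Mapping.lookup (to_R0 p) m =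
    (if m < 0 then 0 else map_poly (\<lambda>t. poly t 0) (coeff p (nat m)))"
proof (induction p arbitrary: m)
  case 0
  show ?case by (simp add: to_R0_hom)
next
  case (pCons a p)
  have "to_R0 (pCons a p) = to_R0 [:a:] + U0 1 * to_R0 p"
    by (simp flip: to_R0_hom to_R0_generators add: U_def)
  moreover have "to_R0 [:a:] = Poly_Mapping.single 0 (map_poly (\<lambda>t. poly t 0) a)"
    by (simp add: to_R0_def map_poly_pCons)
  ultimately show ?case
    using pCons.IH by (auto simp: U0_def lookup_add lookup_single lookup_single_times when_def
        coeff_pCons nat_diff_distrib split: nat.split)
qed

lemma Q0_power_3_dvd_dga_diff: "Q0 ^ 3 dvd dga_diff RR0 p"
  unfolding RR0_def dga.simps by (intro dvd_sum) (auto intro: dvd_mult dvd_mult2)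

lemma lookup_Q0_power_times:
  "Poly_Mapping.lookup (Q0 ^ n * p) m = monom 1 n * Poly_Mapping.lookup p m"
  by (simp add: Q0_power lookup_single_times monom_altdef)

lemma coeff_lookup_Q0_power_dvd:
  assumes "Q0 ^ n dvd p" "k < n"
  shows "coeff (Poly_Mapping.lookup p m) k = 0"
  using assms by (auto simp: lookup_Q0_power_times coeff_monom_mult elim!: dvdE)

lemma Q0_dvdI:
  assumes "\<And>m. coeff (Poly_Mapping.lookup p m) 0 = 0"
  shows "Q0 dvd p"
proof -
  have "Q0 dvd Poly_Mapping.single m c" if c: "coeff c 0 = 0" for m c
  proof -
    obtain c' where "c = [:0, 1:] * c'"
      using c by (cases c) auto
    then have "Poly_Mapping.single m c = Q0 * Poly_Mapping.single m c'"
      by (simp add: Q0_def mult_single)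
    then show ?thesis by simp
  qed
  then have "Q0 dvd (\<Sum>m\<in>Poly_Mapping.keys p. Poly_Mapping.single m (Poly_Mapping.lookup p m))"
    using assms by (intro dvd_sum) blast
  then show ?thesis by (simp add: pm_sum_single)
qed

section \<open>Cycles of the tensor power modulo \<open>U\<close>\<close>

text \<open>The linear part of the differential of \<open>M\<close> modulo \<open>U\<close>; the outer variable is now \<open>Q\<close>.\<close>

definition M_red :: "(M_gen \<Rightarrow> bit poly poly) \<Rightarrow> M_gen \<Rightarrow> bit poly poly" where
  "M_red f b = (\<Sum>a\<in>UNIV. f a * poly (Poly_Mapping.lookup (M_diff a) b) 0)"

lemma poly_coeff_diff_M: "poly (coeff_diff M f b) 0 = M_red (\<lambda>a. poly (f a) 0) b"
  by (simp add: coeff_diff_def M_red_def poly_sum)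

lemma poly_R_generators:
  "poly U 0 = 0" "poly Q 0 = [:0, 1:]" "poly \<theta> 0 = [:[:0, 1:]:]"
  by (simp_all add: U_def Q_def \<theta>_def)

lemma bit_poly_add_self [simp]: "x + x = 0" for x :: "bit poly"
  by (rule poly_eqI) (metis bit_2_eq_0 coeff_0 coeff_add mult_2 mult_zero_left)

lemma bit_poly_poly_add_self [simp]: "x + x = 0" "x + (x + y) = y" for x y :: "bit poly poly"
proof -
  show "x + x = 0" by (rule poly_eqI) (simp only: coeff_add coeff_0 bit_poly_add_self)
  then show "x + (x + y) = y" by (simp flip: add.assoc)
qed

text \<open>The rows at \<open>Yp1\<close> and \<open>Ym1\<close> agree up to multiples of
  \<open>q^2\<close>; this drives the cancellations when they are added.\<close>

lemma M_red_simps: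
  fixes q T :: "bit poly poly"
  defines "q \<equiv> [:0, 1:]" and "T \<equiv> [:[:0, 1:]:]"
  shows "M_red f X0 = 0"
    and "M_red f Xp1 = q * (f Xp1 + f Xm1)"
    and "M_red f Yp1 = T^2 * f X0 + q * (f Yp1 + f Ym1)"
    and "M_red f Ym1 = (T^2 + q^2) * f X0 + q^2 * f Xp1 + q * (f Yp1 + f Ym1)"
  unfolding q_def T_def
  by (simp_all add: M_red_def UNIV_M_gen lookup_add lookup_single when_def poly_R_generators
      distrib_left distrib_right mult.commute add_ac del: mult_pCons_left mult_pCons_right)

lemma X_power_dvd_iff: "[:0, 1:] ^ n dvd p \<longleftrightarrow> (\<forall>k<n. coeff p k = 0)"
  for p :: "bit poly poly"
  using monom_1_dvd_iff'[of n p] by (simp add: monom_altdef)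

text \<open>\<theta> is a nonzero constant with respect to the outer variable, so multiplying by its
  powers acts injectively on each coefficient.\<close>

lemma X_power_dvd_cancel:
  fixes p :: "bit poly poly"
  assumes "[:0, 1:] ^ n dvd [:[:0, 1:]:] ^ k * p"
  shows "[:0, 1:] ^ n dvd p"
proof -
  have "[:[:0, 1:]:] ^ k = [:[:0, 1:] ^ k :: bit poly:]"
    by (induction k) (simp_all add: one_pCons)
  with assms show ?thesis
    by (simp add: X_power_dvd_iff)
qed

lemma cycle_coeff_Q2:
  fixes z :: "((M_gen \<times> M_gen) \<times> M_gen) \<times> M_gen \<Rightarrow>\<^sub>0 R"
  assumes "mdiff RR (M \<otimes>\<^sub>d\<^sub>g M \<otimes>\<^sub>d\<^sub>g M \<otimes>\<^sub>d\<^sub>g M) z = 0"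
  shows "coeff (coeff (Poly_Mapping.lookup z (((X0, X0), X0), X0)) 0) 2 = 0"
proof -
  define q T :: "bit poly poly" where "q = [:0, 1:]" and "T = [:[:0, 1:]:]"
  define F where "F a b c = poly (Poly_Mapping.lookup z (((a, b), c), X0)) 0" for a b c
  define D where "D a b c =
    M_red (\<lambda>a. F a b c) a + M_red (\<lambda>b. F a b c) b + M_red (\<lambda>c. F a b c) c" for a b c
  note red = M_red_simps[folded q_def T_def]
  have D: "q ^ 3 dvd D a b c" for a b c
  proof -
    have "poly (Poly_Mapping.lookup (mdiff RR (M \<otimes>\<^sub>d\<^sub>g M \<otimes>\<^sub>d\<^sub>g M \<otimes>\<^sub>d\<^sub>g M) z) (((a, b), c), X0)) 0 = 0"
      by (simp add: assms)
    \<comment> \<open>The fourth slot is frozen at \<open>X0\<close>, where its term vanishes. The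
      derivation part lies in \<open>q ^ 3\<close> because $dU = Q^3$.\<close>
    then have "poly (dga_diff RR (Poly_Mapping.lookup z (((a, b), c), X0))) 0 + D a b c = 0"
      by (simp add: RR.lookup_mdiff coeff_diff_tensor D_def F_def poly_coeff_diff_M
          M_red_simps(1) add_ac)
    moreover have "q ^ 3 dvd poly (dga_diff RR (Poly_Mapping.lookup z (((a, b), c), X0))) 0"
      by (simp add: RR_def poly_R_generators q_def)
    ultimately show ?thesis
      by (metis dvd_0_right dvd_add_right_iff)
  qed
  have q: "q dvd p \<longleftrightarrow> poly p 0 = 0" for p
    using X_power_dvd_iff[of 1 p] by (simp add: q_def poly_0_coeff_0)
  have D0: "poly (D a b c) 0 = 0" for a b c
    using dvd_trans[OF _ D[of a b c], of q] by (simp add: q[symmetric])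
  have q0: "poly q 0 = 0" by (simp add: q_def)
  have T: "q ^ n dvd p" if "q ^ n dvd T ^ k * p" for n k p
    using that X_power_dvd_cancel unfolding q_def T_def by blast
  have q3: "q ^ 3 dvd q ^ m * p" if "q ^ n dvd p" "m + n = 3" for m n p
    using that by (metis dvd_refl mult_dvd_mono power_add)
  define P where "P = F X0 X0 X0"
  define S where "S = F Yp1 X0 X0 + F Ym1 X0 X0"
  define V where "V = F X0 X0 X0 + F Xp1 X0 X0"
  define W where "W = F Yp1 Yp1 X0 + F Yp1 Ym1 X0 + F Ym1 Yp1 X0 + F Ym1 Ym1 X0"
  have "q ^ 3 dvd T^2 * P + q * S + q^2 * V"
    using D[of Ym1 X0 X0] by (simp add: D_def red P_def S_def V_def algebra_simps)
  moreover have "q ^ 3 dvd q^2 * V"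
  proof -
    \<comment> \<open>At \<open>q = 0\<close> only the second slot contributes, and the choices
      \<open>X0\<close> and \<open>Xp1\<close> in the first slot assemble \<open>V\<close>.\<close>
    have "poly (T^2 * V) 0 = poly (D X0 Ym1 X0 + D Xp1 Ym1 X0) 0"
      by (simp add: D_def red V_def q0 algebra_simps)
    then have "q ^ 1 dvd T^2 * V"
      by (simp add: q D0)
    then have "q ^ 1 dvd V" by (rule T)
    then show ?thesis by (rule q3) simp
  qed
  ultimately have 1: "q ^ 3 dvd T^2 * P + q * S"
    by (metis dvd_add_left_iff)
  have 2: "q ^ 3 dvd q * (T^2 * S + q * W)"
  proof -
    \<comment> \<open>The \<open>T^2\<close> terms of the first slot cancel in characteristic 2.
      Precision \<open>q ^ 2\<close> suffices because of the outer factor \<open>q\<close>.\<close>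
    have "D Yp1 Ym1 X0 + D Ym1 Ym1 X0 = T^2 * S + q * W + q^2 * (F X0 Ym1 X0 + F Xp1 Ym1 X0 + S
        + F Yp1 Xp1 X0 + F Ym1 Xp1 X0)"
      by (simp add: D_def red S_def W_def algebra_simps power2_eq_square)
    moreover have "q ^ 2 dvd D a b c" for a b c
      using D by (rule power_le_dvd) simp
    ultimately have "q ^ 2 dvd T^2 * S + q * W"
      by (metis dvd_add dvd_add_left_iff dvd_triv_left)
    then show ?thesis using q3[of 2 _ 1] by simp
  qed
  have 3: "q ^ 3 dvd q^2 * (T^2 * W)"
  proof -
    \<comment> \<open>Over all sign choices in the first two slots their own \<open>T^2\<close>
      terms cancel in pairs, leaving those of the third slot.\<close>
    have "poly (T^2 * W) 0 =
        poly (D Yp1 Yp1 Ym1 + D Yp1 Ym1 Ym1 + D Ym1 Yp1 Ym1 + D Ym1 Ym1 Ym1) 0"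
      by (simp add: D_def red W_def q0 algebra_simps)
    then have "q ^ 1 dvd T^2 * W"
      by (simp add: q D0)
    then show ?thesis by (rule q3) simp
  qed
  \<comment> \<open>Telescoping in characteristic 2: the mixed terms with \<open>S\<close> and with
    \<open>W\<close> each occur twice.\<close>
  have "T^6 * P = T^4 * (T^2 * P + q * S) + T^2 * (q * (T^2 * S + q * W)) + q^2 * (T^2 * W)"
    by (simp add: algebra_simps numeral_eq_Suc)
  then have "q ^ 3 dvd T ^ 6 * P"
    using 1 2 3 by simp
  then have "q ^ 3 dvd P" by (rule T)
  then show ?thesis
    by (simp add: P_def F_def q_def X_power_dvd_iff poly_0_coeff_0)
qed

section \<open>Localised cycles and the obstruction\<close>

lemma lookup_M_diff_X0 [simp]: "Poly_Mapping.lookup (M_diff a) X0 = 0"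
  by (cases a) (simp_all add: lookup_add lookup_single)

text \<open>A cycle only modulo \<open>\<theta>\<close>; the terms with \<open>Q\<close> compensate $dU = Q^3$.\<close>

definition M_cycle :: "M_gen \<Rightarrow>\<^sub>0 R" where
  "M_cycle = 1 \<cdot> X0 + 1 \<cdot> Xp1 + 1 \<cdot> Xm1 + 1 \<cdot> Xp2 + 1 \<cdot> Xm2
     + U \<cdot> Xp3 + (U + Q^2) \<cdot> Xm3 + U^3 \<cdot> Xp4 + (U^3 + U^2 * Q^2) \<cdot> Xm4 + U^6 \<cdot> Xp5 + U^6 \<cdot> Xm5"

lemma to_R0_power: "to_R0 (p ^ n) = to_R0 p ^ n"
  by (induction n) (simp_all add: to_R0_hom)

lemma bc_vec_mdiff_M_cycle: "bc_vec (mdiff RR M M_cycle) = 0"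
proof (rule poly_mapping_eqI)
  fix b
  show "Poly_Mapping.lookup (bc_vec (mdiff RR M M_cycle)) b = Poly_Mapping.lookup 0 b"
    by (cases b)
       (simp_all add: M_cycle_def RR.mdiff_add RR.mdiff_single lookup_add lookup_single
         scale.scale_right_distrib dga_diff_R_add dga_diff_R_mult dga_diff_R_power
         to_R0_hom to_R0_power to_R0_generators numeral_eq_Suc algebra_simps)
qed

text \<open>Differentiating before base change makes the Leibniz rule over \<open>RR\<close>
  available; \<open>to_R0\<close> then kills one factor of each product.\<close>

lemma bc_vec_mdiff_tens:
  assumes "bc_vec (mdiff RR A v) = 0" "bc_vec (mdiff RR B w) = 0"
  shows "bc_vec (mdiff RR (A \<otimes>\<^sub>d\<^sub>g B) (tens v w)) = 0"
proof -
  have "to_R0 (Poly_Mapping.lookup (mdiff RR A v) a) = 0"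
    "to_R0 (Poly_Mapping.lookup (mdiff RR B w) b) = 0" for a b
    using assms by (metis lookup_bc_vec lookup_zero)+
  then show ?thesis
    by (intro poly_mapping_eqI) (auto simp: RR.mdiff_tens lookup_add to_R0_hom)
qed

theorem corollary6p10:
  shows "\<not> (\<exists>f. local_map self_dgm (M \<otimes>\<^sub>d\<^sub>g M \<otimes>\<^sub>d\<^sub>g M \<otimes>\<^sub>d\<^sub>g M) 2 f)"
proof
  define A where "A = M \<otimes>\<^sub>d\<^sub>g M \<otimes>\<^sub>d\<^sub>g M \<otimes>\<^sub>d\<^sub>g M"
  define x where "x = (((X0, X0), X0), X0)"
  assume "\<exists>f. local_map self_dgm (M \<otimes>\<^sub>d\<^sub>g M \<otimes>\<^sub>d\<^sub>g M \<otimes>\<^sub>d\<^sub>g M) 2 f"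
  then obtain f f' h where f: "dg_map RR self_dgm A 2 f"
    and f': "dg_map RR0 (bc_dgm self_dgm) (bc_dgm A) 0 f'"
    and qi: "quasi_iso RR0 (bc_dgm self_dgm) (bc_dgm A) f'"
    and h: "module_hom scale scale h"
      "\<And>v. bc_map f v - scale (Q0 ^ 2) (f' v) =
         mdiff RR0 (bc_dgm A) (h v) + h (mdiff RR0 (bc_dgm self_dgm) v)"
    unfolding local_map_def dg_homotopic_def A_def by auto
  interpret f: module_hom scale scale f using f by (simp add: dg_map_def)
  interpret f': module_hom scale scale f' using f' by (simp add: dg_map_def)
  interpret h: module_hom scale scale h by fact
  define c where "c = Poly_Mapping.lookup (f (gen ())) x"
  define g where "g = Poly_Mapping.lookup (f' (gen ())) x"

  have diff_x: "Poly_Mapping.lookup (mdiff RR0 (bc_dgm A) v) x =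
      dga_diff RR0 (Poly_Mapping.lookup v x)" for v
  proof -
    have "Poly_Mapping.lookup (gen_diff A b) x = 0" for b
      by (cases b) (auto simp: A_def x_def tensor_def lookup_add)
    then show ?thesis
      by (simp add: RR0.lookup_mdiff coeff_diff_def bc_dgm_def to_R0_hom)
  qed

  have "mdiff RR A (f (gen ())) = f (mdiff RR self_dgm (gen ()))"
    using f by (simp add: dg_map_def)
  also have "\<dots> = 0" by (simp add: self_dgm_diff)
  finally have "coeff (coeff c 0) 2 = 0"
    unfolding A_def c_def x_def by (rule cycle_coeff_Q2)
  then have "coeff (Poly_Mapping.lookup (to_R0 c) 0) 2 = 0"
    by (simp add: lookup_to_R0 coeff_map_poly)
  \<comment> \<open>Since \<open>gen ()\<close> is a cycle, only the boundary term of the homotopy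
    survives. It is a multiple of \<open>Q0 ^ 3\<close>, so it cannot affect the coefficient of
    $Q^2$.\<close>
  moreover have "to_R0 c - Q0 ^ 2 * g = dga_diff RR0 (Poly_Mapping.lookup (h (gen ())) x)"
  proof -
    have "bc_map f (gen ()) = bc_vec (f (gen ()))"
      using bc_map_bc_vec[OF f.module_hom_axioms, of "gen ()"] by (simp add: bc_vec_hom to_R0_hom)
    moreover have "mdiff RR0 (bc_dgm self_dgm) (gen ()) = 0"
      by (auto intro!: poly_mapping_eqI simp: RR0.mdiff_gen bc_dgm_def self_dgm_def to_R0_hom)
    ultimately have "bc_vec (f (gen ())) - scale (Q0 ^ 2) (f' (gen ())) =
        mdiff RR0 (bc_dgm A) (h (gen ()))"
      using h(2)[of "gen ()"] by simp
    then have "Poly_Mapping.lookup (bc_vec (f (gen ())) - scale (Q0 ^ 2) (f' (gen ()))) x =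
        dga_diff RR0 (Poly_Mapping.lookup (h (gen ())) x)"
      by (simp only: diff_x)
    then show ?thesis by (simp add: lookup_minus c_def g_def)
  qed
  then have "Q0 ^ 2 * g = to_R0 c - dga_diff RR0 (Poly_Mapping.lookup (h (gen ())) x)"
    by (simp add: algebra_simps)
  ultimately have "coeff (Poly_Mapping.lookup (Q0 ^ 2 * g) 0) 2 = 0"
    using coeff_lookup_Q0_power_dvd[OF Q0_power_3_dvd_dga_diff, of 2 _ 0]
    by (simp add: lookup_minus)
  then have g0: "coeff (Poly_Mapping.lookup g 0) 0 = 0"
    by (simp add: lookup_Q0_power_times coeff_monom_mult)

  have "f' (gen ()) \<in> mcomp RR0 (bc_dgm A) 0"
  proof -
    have "gen () \<in> mcomp RR0 (bc_dgm self_dgm) 0"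
      by (auto simp: mcomp_def bc_dgm_def self_dgm_def RR0_def lookup_one when_def)
    then show ?thesis using f' unfolding dg_map_def by fastforce
  qed
  \<comment> \<open>As \<open>x\<close> has degree 0, a monomial of \<open>g\<close> free of $Q$
    must be the constant, which \<open>g0\<close> excludes.\<close>
  then have "2 * m + int b = 0" if "coeff (Poly_Mapping.lookup g m) b \<noteq> 0" for m b
    using that by (auto simp: mcomp_def A_def x_def tensor_def bc_dgm_def RR0_def g_def)
  then have "coeff (Poly_Mapping.lookup g m) 0 = 0" for m
    using g0 by (cases "m = 0") force+
  then have "Q0 dvd g" by (rule Q0_dvdI)

  \<comment> \<open>A localised cycle whose coordinate at \<open>x\<close> is 1, used to test
    surjectivity of \<open>f'\<close> on homology.\<close>
  define w where "w = bc_vec (tens (tens (tens M_cycle M_cycle) M_cycle) M_cycle)"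
  have "mdiff RR0 (bc_dgm A) w = 0"
    unfolding w_def A_def mdiff_bc_vec by (intro bc_vec_mdiff_tens bc_vec_mdiff_M_cycle)
  then have "hclass RR0 (bc_dgm A) w \<in> homology RR0 (bc_dgm A)"
    by (simp add: homology_def)
  then obtain Z where "hclass RR0 (bc_dgm A) w = (\<Union>z\<in>Z. hclass RR0 (bc_dgm A) (f' z))"
    using qi unfolding quasi_iso_def bij_betw_def by blast
  moreover have "w \<in> hclass RR0 (bc_dgm A) w"
    by (auto simp: hclass_def intro!: exI[of _ 0] simp: mdiff_def lin_ext_def)
  ultimately obtain z v where "w = f' z + mdiff RR0 (bc_dgm A) v"
    by (auto simp: hclass_def)
  then have "Poly_Mapping.lookup w x =
      Poly_Mapping.lookup (f' z) x + dga_diff RR0 (Poly_Mapping.lookup v x)"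
    by (simp add: lookup_add diff_x)
  moreover have "Poly_Mapping.lookup w x = 1"
    by (simp add: w_def x_def M_cycle_def lookup_add lookup_single to_R0_hom)
  \<comment> \<open>The source has rank one, so every value of \<open>f'\<close> has its coordinate
    at \<open>x\<close> in the ideal of \<open>g\<close>, hence of \<open>Q0\<close>.\<close>
  moreover have "Poly_Mapping.lookup (f' z) x = Poly_Mapping.lookup z () * g"
  proof -
    have "z = scale (Poly_Mapping.lookup z ()) (gen ())"
      by (rule poly_mapping_eqI) simp
    then show ?thesis
      by (metis f'.scale g_def lookup_scale)
  qed
  moreover have "Q0 dvd dga_diff RR0 (Poly_Mapping.lookup v x)"
    using Q0_power_3_dvd_dga_diff by (rule dvd_trans[rotated]) simp
  ultimately have "Q0 ^ 1 dvd 1"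
    using \<open>Q0 dvd g\<close> by (metis dvd_add dvd_mult power_one_right)
  then show False
    using coeff_lookup_Q0_power_dvd[of 1 1 0 0] by (simp add: lookup_one)
qed

end
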